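(* Let $T$ be a non-degenerate triangle in a Euclidean space. If the largest angle of $T$ is strictly smaller than $135^\circ$, then $T$ is diameter-Ramsey.
   Context: For a finite Euclidean set $P$, $\operatorname{diam}(P)=\max\{\|x-y\|:x,y\in P\}$. A finite set $P$ in a Euclidean space is called diameter-Ramsey if for every integer $r\ge2$ there exist an integer $D$ and a finite set $R\subset\mathbb{R}^D$ with $\operatorname{diam}(R)=\operatorname{diam}(P)$ such that every coloring of the points of $R$ with $r$ colors contains a monochromatic subset congruent to $P$. *)

theory Defs
  imports "HOL-Analysis.Analysis"
begin

text \<open>
  The dimension of the space containing the Ramsey set is existentially quantified, so it cannot be
  a type.  The space \<open>\<real>^D\<close> is therefore the carrier of the library topology
  \<^const>\<open>Euclidean_space\<close>, i.e. the sequences \<open>x :: nat \<Rightarrow> real\<close> with \<open>x i = 0\<close> for all \<open>i \<ge> D\<close>.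
  The type class metric on \<open>nat \<Rightarrow> real\<close> is not the Euclidean one, hence an explicit
  distance.
\<close>

definition Rdist :: "nat \<Rightarrow> (nat \<Rightarrow> real) \<Rightarrow> (nat \<Rightarrow> real) \<Rightarrow> real" where
  "Rdist D x y = L2_set (\<lambda>i. x i - y i) {..<D}"

text \<open>
  The next two notions take distance functions as arguments because they are used both for
  \<^const>\<open>dist\<close> on a type of class \<^class>\<open>euclidean_space\<close> and for \<^const>\<open>Rdist\<close>.
  The value of \<open>diam\<close> is meaningful for finite nonempty sets only.
\<close>

definition diam :: "('a \<Rightarrow> 'a \<Rightarrow> real) \<Rightarrow> 'a set \<Rightarrow> real" where
  "diam d P = Max {d x y | x y. x \<in> P \<and> y \<in> P}"

definition congruent_sets ::
    "('a \<Rightarrow> 'a \<Rightarrow> real) \<Rightarrow> 'a set \<Rightarrow> ('b \<Rightarrow> 'b \<Rightarrow> real) \<Rightarrow> 'b set \<Rightarrow> bool" where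
  "congruent_sets d P e Q \<longleftrightarrow>
     (\<exists>f. bij_betw f P Q \<and> (\<forall>x\<in>P. \<forall>y\<in>P. e (f x) (f y) = d x y))"

definition diameter_Ramsey :: "'a::euclidean_space set \<Rightarrow> bool" where
  "diameter_Ramsey P \<longleftrightarrow> finite P \<and>
     (\<forall>r::nat. r \<ge> 2 \<longrightarrow>
        (\<exists>D R. R \<subseteq> topspace (Euclidean_space D) \<and> finite R \<and>
           diam (Rdist D) R = diam dist P \<and>
           (\<forall>c::(nat \<Rightarrow> real) \<Rightarrow> nat. c ` R \<subseteq> {..<r} \<longrightarrow>
              (\<exists>Q k. Q \<subseteq> R \<and> (\<forall>x\<in>Q. c x = k) \<and>
                 congruent_sets dist P (Rdist D) Q))))"

text \<open>
  The angle at \<open>B\<close> between the rays from \<open>B\<close> through \<open>A\<close> and \<open>C\<close>, in radians and in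
  \<open>[0, \<pi>]\<close>; meaningful only for \<open>A \<noteq> B\<close> and \<open>C \<noteq> B\<close>.
\<close>

definition vertex_angle :: "'a::euclidean_space \<Rightarrow> 'a \<Rightarrow> 'a \<Rightarrow> real" where
  "vertex_angle A B C = arccos (((A - B) \<bullet> (C - B)) / (norm (A - B) * norm (C - B)))"

lemma diam_dist_eq_diameter:
  fixes P :: "'a::metric_space set"
  assumes "finite P" "P \<noteq> {}"
  shows "diam dist P = diameter P"
proof -
  have eq: "{dist x y | x y. x \<in> P \<and> y \<in> P} = (\<lambda>(x, y). dist x y) ` (P \<times> P)"
    by auto
  show ?thesis
    using assms unfolding diam_def diameter_def eq by (auto simp: cSup_eq_Max)
qed

end

theory Submission
  imports Defs "HOL-Library.Ramsey"
begin

text \<open>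
  Let \<open>l\<close> be the longest side. The angle condition says precisely that the circumradius is smaller
  than \<open>l / sqrt 2\<close>, so the triangle can be placed on a sphere of radius \<open>l / sqrt 2\<close> about the
  origin; the endpoints of the longest side then become orthogonal, and all inner products are
  nonnegative. Conversely, points of the nonnegative orthant on that sphere have mutual distance at
  most \<open>l\<close>. As in the work of Matousek and Rodl on spherical Ramsey sets, the points to be coloured
  are all vectors whose nonzero coordinates, read in order, form a fixed list \<open>\<alpha>\<close>. Such a vector is
  determined by its support, so Ramsey's theorem for hypergraphs yields a large set of coordinates
  on which all of them have the same colour, and it remains to find \<open>\<alpha>\<close> and three interleavings of
  \<open>\<alpha>\<close> with zeros that have the inner products of the triangle.

  For this take \<open>p\<^sup>2 + q\<^sup>2 = 1\<close> and the lists \<open>L\<^sub>0 = []\<close>, \<open>L\<^sub>n\<^sub>+\<^sub>1 = 1, p L\<^sub>n, q L\<^sub>n\<close>, of squared norm \<open>n\<close>.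
  The list \<open>L\<^sub>n\<close> is also a sublist of \<open>L\<^sub>n\<^sub>+\<^sub>1\<close>, hence two disjoint copies of \<open>L\<^sub>n\<^sub>+\<^sub>1\<close> can be made to
  overlap with the parts \<open>p L\<^sub>n\<close> and \<open>q L\<^sub>n\<close> of a third one. The inner products are \<open>p n\<close> and \<open>q n\<close>,
  and \<open>p n / (n + 1)\<close> and \<open>q n / (n + 1)\<close> after normalisation, arbitrarily close to the unit circle.
  Appending an entry that never overlaps scales them down to the exact values required.
\<close>

section \<open>Vectors with prescribed nonzero entries\<close>

abbreviation nonzeros :: "real list \<Rightarrow> real list" where
  "nonzeros \<equiv> filter (\<lambda>x. x \<noteq> 0)"

definition pattern_vectors :: "nat \<Rightarrow> real list \<Rightarrow> (nat \<Rightarrow> real) set" where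
  "pattern_vectors D \<alpha> = {v. (\<forall>i\<ge>D. v i = 0) \<and> nonzeros (map v [0..<D]) = \<alpha>}"

abbreviation support :: "(nat \<Rightarrow> real) \<Rightarrow> nat set" where
  "support v \<equiv> {i. v i \<noteq> 0}"

lemma nonzeros_map:
  "nonzeros (map v xs) = map v (filter (\<lambda>i. v i \<noteq> 0) xs)"
  by (simp add: filter_map o_def)

lemma pattern_vectors_support:
  assumes "v \<in> pattern_vectors D \<alpha>"
  shows "support v \<subseteq> {..<D}"
    and "map v (sorted_list_of_set (support v)) = \<alpha>"
    and "card (support v) = length \<alpha>"
proof -
  show sub: "support v \<subseteq> {..<D}"
    using assms unfolding pattern_vectors_def by (auto simp: not_less[symmetric])
  have "filter (\<lambda>i. v i \<noteq> 0) [0..<D] = sorted_list_of_set (support v)"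
  proof (rule sorted_distinct_set_unique)
    show "sorted (filter (\<lambda>i. v i \<noteq> 0) [0..<D])"
      by (intro sorted_wrt_filter sorted_upt)
    show "set (filter (\<lambda>i. v i \<noteq> 0) [0..<D]) = set (sorted_list_of_set (support v))"
      using sub finite_subset[OF sub] by auto
  qed auto
  then show eq: "map v (sorted_list_of_set (support v)) = \<alpha>"
    using assms unfolding pattern_vectors_def by (simp add: nonzeros_map)
  show "card (support v) = length \<alpha>"
    using arg_cong[OF eq, of length] by simp
qed

lemma pattern_vectors_eqI:
  assumes u: "u \<in> pattern_vectors D \<alpha>" and v: "v \<in> pattern_vectors D \<alpha>"
    and "support u = support v"
  shows "u = v"
proof
  fix i
  have "finite (support v)"
    using finite_subset[OF pattern_vectors_support(1)[OF v]] by simp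
  moreover have "map u (sorted_list_of_set (support v)) = map v (sorted_list_of_set (support v))"
    using pattern_vectors_support(2)[OF u] pattern_vectors_support(2)[OF v] assms(3) by simp
  ultimately have "u i = v i" if "v i \<noteq> 0"
    using that by simp
  moreover have "u i \<noteq> 0 \<longleftrightarrow> v i \<noteq> 0"
    using assms(3) by (simp add: set_eq_iff)
  ultimately show "u i = v i" by metis
qed

lemma finite_pattern_vectors: "finite (pattern_vectors D \<alpha>)"
proof (rule inj_on_finite)
  show "inj_on support (pattern_vectors D \<alpha>)"
    by (rule inj_onI) (rule pattern_vectors_eqI)
  show "support ` pattern_vectors D \<alpha> \<subseteq> Pow {..<D}"
    using pattern_vectors_support(1) by blast
qed simp

lemma pattern_vectors_nonneg:
  assumes "v \<in> pattern_vectors D \<alpha>" "\<forall>x\<in>set \<alpha>. 0 \<le> x"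
  shows "0 \<le> v i"
proof (cases "v i = 0")
  case False
  then have "i < D" using assms(1) by (auto simp: pattern_vectors_def not_less[symmetric])
  with False have "v i \<in> set \<alpha>"
    using assms(1) by (auto simp: pattern_vectors_def)
  then show ?thesis using assms(2) by blast
qed simp

lemma sum_list_nonzeros:
  fixes f :: "real \<Rightarrow> real"
  assumes "f 0 = 0"
  shows "sum_list (map f (nonzeros xs)) = sum_list (map f xs)"
  using assms by (induction xs) auto

lemma pattern_vectors_norm:
  assumes "v \<in> pattern_vectors D \<alpha>"
  shows "(\<Sum>i<D. (v i)\<^sup>2) = (\<Sum>x\<leftarrow>\<alpha>. x\<^sup>2)"
proof -
  have "(\<Sum>x\<leftarrow>\<alpha>. x\<^sup>2) = (\<Sum>x\<leftarrow>nonzeros (map v [0..<D]). x\<^sup>2)"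
    using assms by (simp add: pattern_vectors_def)
  also have "\<dots> = (\<Sum>x\<leftarrow>map v [0..<D]. x\<^sup>2)"
    by (rule sum_list_nonzeros) simp
  also have "\<dots> = (\<Sum>i<D. (v i)\<^sup>2)"
    by (simp add: interv_sum_list_conv_sum_set_nat atLeast0LessThan o_def)
  finally show ?thesis by simp
qed

text \<open>Nonnegative entries make the inner product nonnegative, so the squared distance is at
  most the sum of the two squared norms.\<close>

lemma pattern_vectors_Rdist_le:
  assumes u: "u \<in> pattern_vectors D \<alpha>" and v: "v \<in> pattern_vectors D \<alpha>"
    and "\<forall>x\<in>set \<alpha>. 0 \<le> x"
  shows "Rdist D u v \<le> sqrt (2 * (\<Sum>x\<leftarrow>\<alpha>. x\<^sup>2))"
proof -
  have "(\<Sum>i<D. (u i - v i)\<^sup>2) \<le> (\<Sum>i<D. (u i)\<^sup>2 + (v i)\<^sup>2)"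
  proof (rule sum_mono)
    fix i
    have "0 \<le> u i * v i"
      using pattern_vectors_nonneg[OF u assms(3)] pattern_vectors_nonneg[OF v assms(3)] by simp
    then show "(u i - v i)\<^sup>2 \<le> (u i)\<^sup>2 + (v i)\<^sup>2"
      by (simp add: power2_diff)
  qed
  then show ?thesis
    by (simp add: Rdist_def L2_set_def sum.distrib pattern_vectors_norm[OF u]
        pattern_vectors_norm[OF v])
qed

section \<open>Placing lists on chosen coordinates, and Ramsey's theorem\<close>

definition spread :: "(nat \<Rightarrow> nat) \<Rightarrow> real list \<Rightarrow> nat \<Rightarrow> real" where
  "spread h w i = (if i \<in> h ` {..<length w} then w ! inv_into {..<length w} h i else 0)"

lemma spread_apply:
  assumes "inj_on h {..<length w}" "j < length w"
  shows "spread h w (h j) = w ! j"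
  using assms by (simp add: spread_def)

lemma spread_outside: "i \<notin> h ` {..<length w} \<Longrightarrow> spread h w i = 0"
  by (simp add: spread_def)

text \<open>An increasing \<open>h\<close> preserves the order of the entries. Since
  \<open>w\<close> may itself contain zeros, the support can be a proper subset of the image of
  \<open>h\<close>.\<close>

lemma spread_in_pattern_vectors:
  assumes mono: "strict_mono_on {..<length w} h" and ran: "h ` {..<length w} \<subseteq> {..<D}"
  shows "spread h w \<in> pattern_vectors D (nonzeros w)"
proof -
  define m where "m = length w"
  have inj: "inj_on h {..<m}"
    using mono by (simp add: m_def strict_mono_on_imp_inj_on)
  have eq: "filter (\<lambda>i. i \<in> h ` {..<m}) [0..<D] = map h [0..<m]"
  proof (rule sorted_distinct_set_unique)
    show "sorted (map h [0..<m])"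
      using mono unfolding m_def sorted_iff_nth_mono
      by (auto intro: strict_mono_on_leD)
    show "distinct (map h [0..<m])"
      using inj by (simp add: distinct_map atLeast0LessThan)
    show "set (filter (\<lambda>i. i \<in> h ` {..<m}) [0..<D]) = set (map h [0..<m])"
      using ran[folded m_def] by (auto simp: atLeast0LessThan)
    show "sorted (filter (\<lambda>i. i \<in> h ` {..<m}) [0..<D])"
      by (intro sorted_wrt_filter sorted_upt)
  qed auto
  \<comment> \<open>The support lies in the image of \<open>h\<close>, so filtering by that image
    first loses nothing and turns the coordinates into the enumeration by \<open>h\<close>.\<close>
  have "nonzeros (map (spread h w) [0..<D])
      = map (spread h w) (filter (\<lambda>i. spread h w i \<noteq> 0) (filter (\<lambda>i. i \<in> h ` {..<m}) [0..<D]))"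
    unfolding nonzeros_map filter_filter
    by (intro arg_cong2[where f=map] filter_cong refl) (auto simp: m_def spread_def)
  also have "\<dots> = nonzeros (map (spread h w) (map h [0..<m]))"
    unfolding eq nonzeros_map ..
  also have "map (spread h w) (map h [0..<m]) = w"
    by (rule nth_equalityI) (use inj in \<open>auto simp: m_def spread_apply\<close>)
  finally show ?thesis
    using ran by (auto simp: pattern_vectors_def intro!: spread_outside)
qed

lemma Rdist_spread:
  assumes inj: "inj_on h {..<m}" and ran: "h ` {..<m} \<subseteq> {..<D}"
    and "length u = m" "length w = m"
  shows "Rdist D (spread h u) (spread h w) = sqrt (\<Sum>j<m. (u ! j - w ! j)\<^sup>2)"
proof -
  have "(\<Sum>i<D. (spread h u i - spread h w i)\<^sup>2)
      = (\<Sum>i\<in>h ` {..<m}. (spread h u i - spread h w i)\<^sup>2)"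
    by (rule sum.mono_neutral_right) (use ran assms in \<open>auto simp: spread_def\<close>)
  also have "\<dots> = (\<Sum>j<m. (u ! j - w ! j)\<^sup>2)"
    using inj assms(3,4) by (simp add: sum.reindex spread_apply)
  finally show ?thesis by (simp add: Rdist_def L2_set_def)
qed

text \<open>Each vector passes its colour to its support, a set of size
  \<open>length \<alpha>\<close>. Ramsey's theorem gives a homogeneous set of \<open>m\<close>
  coordinates, and its increasing enumeration \<open>h\<close> serves all lists \<open>w\<close> at
  once.\<close>

lemma monochromatic_spread:
  fixes m r :: nat and \<alpha> :: "real list"
  assumes "0 < r"
  shows "\<exists>D. \<forall>c :: (nat \<Rightarrow> real) \<Rightarrow> nat. c ` pattern_vectors D \<alpha> \<subseteq> {..<r} \<longrightarrow>
    (\<exists>h k. strict_mono_on {..<m} h \<and> h ` {..<m} \<subseteq> {..<D} \<and>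
      (\<forall>w. length w = m \<and> nonzeros w = \<alpha> \<longrightarrow> c (spread h w) = k))"
proof -
  obtain D :: nat where D: "partn_lst {..<D} (replicate r m) (length \<alpha>)"
    using ramsey_full[of "replicate r m" "length \<alpha>"] by blast
  have "\<exists>h k. strict_mono_on {..<m} h \<and> h ` {..<m} \<subseteq> {..<D} \<and>
      (\<forall>w. length w = m \<and> nonzeros w = \<alpha> \<longrightarrow> c (spread h w) = k)"
    if c: "c ` pattern_vectors D \<alpha> \<subseteq> {..<r}" for c :: "(nat \<Rightarrow> real) \<Rightarrow> nat"
  proof -
    let ?V = "\<lambda>S v. v \<in> pattern_vectors D \<alpha> \<and> support v = S"
    \<comment> \<open>The colouring must be total on sets; the default 0 is a legal colour because
      \<open>0 < r\<close>.\<close>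
    define f where "f S = (if \<exists>v. ?V S v then c (SOME v. ?V S v) else 0)" for S
    have f: "f (support v) = c v" if "v \<in> pattern_vectors D \<alpha>" for v
    proof -
      have "?V (support v) (SOME u. ?V (support v) u)"
        by (rule someI[where x=v]) (use that in simp)
      then have "(SOME u. ?V (support v) u) = v"
        using pattern_vectors_eqI that by blast
      then show ?thesis using that by (auto simp: f_def)
    qed
    have "f S < r" for S
    proof (cases "\<exists>v. ?V S v")
      case True
      then obtain v where "v \<in> pattern_vectors D \<alpha>" "support v = S" by blast
      then show ?thesis using f[of v] c by auto
    qed (use assms in \<open>auto simp: f_def\<close>)
    then have "f \<in> nsets {..<D} (length \<alpha>) \<rightarrow> {..<length (replicate r m)}" by simp
    then obtain k H where H: "k < r" "H \<in> nsets {..<D} m" "f ` nsets H (length \<alpha>) \<subseteq> {k}"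
      using D unfolding partn_lst_def by (fastforce simp: monochromatic_def)
    then have finH: "finite H" "card H = m" "H \<subseteq> {..<D}"
      by (auto simp: nsets_def)
    define h where "h j = sorted_list_of_set H ! j" for j
    have mono: "strict_mono_on {..<m} h"
      using finH unfolding strict_mono_on_def h_def
      by (auto intro!: sorted_wrt_nth_less[OF strict_sorted_list_of_set])
    have img: "h ` {..<m} = H"
      using finH nth_image[of m "sorted_list_of_set H"]
      by (simp add: h_def image_def atLeast0LessThan)
    have "c (spread h w) = k" if "length w = m" "nonzeros w = \<alpha>" for w
    proof -
      have v: "spread h w \<in> pattern_vectors D \<alpha>"
        using spread_in_pattern_vectors[of w h D] mono img finH that by simp
      have "support (spread h w) \<subseteq> H"
        using spread_outside[of _ h w] img that by auto
      with v have "support (spread h w) \<in> nsets H (length \<alpha>)"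
        using finH pattern_vectors_support(3)[OF v] finite_subset[of _ H]
        by (auto simp: nsets_def)
      then show ?thesis using H(3) f[OF v] by auto
    qed
    with mono img finH show ?thesis by blast
  qed
  then show ?thesis by blast
qed


section \<open>A sufficient condition for being diameter-Ramsey\<close>

text \<open>This leaves only the search for lists that agree after deletion of zeros and realise the
  distances of \<open>P\<close>. The diameter condition says that two farthest points become
  orthogonal.\<close>

lemma diameter_RamseyI:
  fixes P :: "'a::euclidean_space set" and w :: "'a \<Rightarrow> real list"
  assumes P: "finite P" "P \<noteq> {}"
    and len: "\<And>x. x \<in> P \<Longrightarrow> length (w x) = m"
    and pat: "\<And>x. x \<in> P \<Longrightarrow> nonzeros (w x) = \<alpha>"
    and nonneg: "\<forall>t\<in>set \<alpha>. 0 \<le> t"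
    and diam: "diam dist P = sqrt (2 * (\<Sum>t\<leftarrow>\<alpha>. t\<^sup>2))"
    and dist: "\<And>x y. x \<in> P \<Longrightarrow> y \<in> P \<Longrightarrow> dist x y = sqrt (\<Sum>j<m. (w x ! j - w y ! j)\<^sup>2)"
  shows "diameter_Ramsey P"
  unfolding diameter_Ramsey_def
proof (intro conjI allI impI)
  fix r :: nat
  assume "2 \<le> r"
  then have "0 < r" by simp
  from monochromatic_spread[OF \<open>0 < r\<close>, of \<alpha> m]
  obtain D where D: "\<forall>c :: (nat \<Rightarrow> real) \<Rightarrow> nat. c ` pattern_vectors D \<alpha> \<subseteq> {..<r} \<longrightarrow>
    (\<exists>h k. strict_mono_on {..<m} h \<and> h ` {..<m} \<subseteq> {..<D} \<and>
      (\<forall>w. length w = m \<and> nonzeros w = \<alpha> \<longrightarrow> c (spread h w) = k))" ..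
  let ?R = "pattern_vectors D \<alpha>"
  have copy: "\<exists>Q k. Q \<subseteq> ?R \<and> (\<forall>x\<in>Q. c x = k) \<and> congruent_sets dist P (Rdist D) Q"
    if c: "c ` ?R \<subseteq> {..<r}" for c :: "(nat \<Rightarrow> real) \<Rightarrow> nat"
  proof -
    from D[THEN spec, THEN mp, OF c]
    obtain h k where h: "strict_mono_on {..<m} h" "h ` {..<m} \<subseteq> {..<D}"
      and k: "\<forall>w. length w = m \<and> nonzeros w = \<alpha> \<longrightarrow> c (spread h w) = k"
      by (elim exE conjE)
    define f where "f x = spread h (w x)" for x
    have R: "f x \<in> ?R" if "x \<in> P" for x
      using spread_in_pattern_vectors[of "w x" h D] h len pat that by (simp add: f_def)
    have d: "Rdist D (f x) (f y) = dist x y" if "x \<in> P" "y \<in> P" for x y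
      using Rdist_spread[OF strict_mono_on_imp_inj_on[OF h(1)] h(2)] len dist that
      by (simp add: f_def)
    have "inj_on f P"
    proof (rule inj_onI)
      fix x y
      assume "x \<in> P" "y \<in> P" "f x = f y"
      then have "dist x y = dist x x"
        using d by metis
      then show "x = y" by simp
    qed
    then have "congruent_sets dist P (Rdist D) (f ` P)"
      unfolding congruent_sets_def using d inj_on_imp_bij_betw by blast
    moreover have "\<forall>x\<in>f ` P. c x = k"
      using k len pat by (auto simp: f_def)
    moreover have "f ` P \<subseteq> ?R"
      using R by blast
    ultimately show ?thesis by blast
  qed
  let ?dP = "{dist x y | x y. x \<in> P \<and> y \<in> P}"
  let ?dR = "{Rdist D u v | u v. u \<in> ?R \<and> v \<in> ?R}"
  have finP: "finite ?dP" "?dP \<noteq> {}"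
    using P by (auto intro: finite_image_set2)
  have finR: "finite ?dR"
    using finite_pattern_vectors by (auto intro: finite_image_set2)
  obtain x y where xy: "x \<in> P" "y \<in> P" "dist x y = Max ?dP"
    using Max_in[OF finP] by force
  have "diam (Rdist D) ?R = diam dist P"
  proof -
    \<comment> \<open>A constant colouring already yields a copy of \<open>P\<close> in
      \<open>?R\<close>, so the upper bound on distances is attained.\<close>
    obtain Q where Q: "Q \<subseteq> ?R" "congruent_sets dist P (Rdist D) Q"
      using copy[of "\<lambda>_. 0"] \<open>0 < r\<close> by auto
    then obtain f where f: "bij_betw f P Q" "Rdist D (f x) (f y) = dist x y"
      using xy unfolding congruent_sets_def by blast
    have "f x \<in> ?R" "f y \<in> ?R"
      using f(1) Q(1) xy(1,2) by (auto dest: bij_betwE)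
    then have "dist x y \<in> ?dR"
      using f(2) by force
    then have "Max ?dR = Max ?dP"
      using finR xy(3) diam pattern_vectors_Rdist_le[OF _ _ nonneg]
      by (intro Max_eqI) (auto simp: diam_def)
    then show ?thesis by (simp add: diam_def)
  qed
  moreover have "?R \<subseteq> topspace (Euclidean_space D)"
    by (auto simp: pattern_vectors_def topspace_Euclidean_space)
  ultimately show "\<exists>D R. R \<subseteq> topspace (Euclidean_space D) \<and> finite R \<and>
           diam (Rdist D) R = diam dist P \<and>
           (\<forall>c::(nat \<Rightarrow> real) \<Rightarrow> nat. c ` R \<subseteq> {..<r} \<longrightarrow>
              (\<exists>Q k. Q \<subseteq> R \<and> (\<forall>x\<in>Q. c x = k) \<and>
                 congruent_sets dist P (Rdist D) Q))"
    using copy finite_pattern_vectors by blast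
qed (rule P)

section \<open>Self-similar lists and their overlaps\<close>

fun tree_seq :: "real \<Rightarrow> real \<Rightarrow> nat \<Rightarrow> real list" where
  "tree_seq p q 0 = []"
| "tree_seq p q (Suc n) = 1 # map ((*) p) (tree_seq p q n) @ map ((*) q) (tree_seq p q n)"

text \<open>
  The first components form \<open>tree_seq p q (Suc n)\<close>, the second ones form \<open>tree_seq p q n\<close>
  interspersed with zeros. For \<open>p = 0\<close> or \<open>q = 0\<close> the lists themselves contain zeros, which is why
  they are compared after \<^const>\<open>filter\<close>.
\<close>

fun tree_overlap :: "real \<Rightarrow> real \<Rightarrow> nat \<Rightarrow> (real \<times> real) list" where
  "tree_overlap p q 0 = [(1, 0)]"
| "tree_overlap p q (Suc n) = (1, 1) #
     map (map_prod ((*) p) ((*) p)) (tree_overlap p q n) @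
     map (map_prod ((*) q) ((*) q)) (tree_overlap p q n)"

lemma nonzeros_scale:
  "nonzeros (map ((*) s) xs) = (if s = 0 then [] else map ((*) s) (nonzeros xs))"
  by (induction xs) auto

lemma sum_list_scale_squares:
  fixes s :: real
  shows "(\<Sum>x\<leftarrow>map ((*) s) xs. x\<^sup>2) = s\<^sup>2 * (\<Sum>x\<leftarrow>xs. x\<^sup>2)"
  by (simp add: o_def power_mult_distrib sum_list_const_mult)

lemma tree_seq_nonneg:
  assumes "0 \<le> p" "0 \<le> q" "x \<in> set (tree_seq p q n)"
  shows "0 \<le> x"
  using assms by (induction n arbitrary: x) auto

lemma tree_seq_norm:
  assumes "p\<^sup>2 + q\<^sup>2 = 1"
  shows "(\<Sum>x\<leftarrow>tree_seq p q n. x\<^sup>2) = real n"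
proof (induction n)
  case (Suc n)
  have "(\<Sum>x\<leftarrow>tree_seq p q (Suc n). x\<^sup>2) = 1 + (p\<^sup>2 + q\<^sup>2) * (\<Sum>x\<leftarrow>tree_seq p q n. x\<^sup>2)"
    unfolding tree_seq.simps map_append sum_list_append list.map(2) sum_list.Cons
      sum_list_scale_squares by (simp add: algebra_simps)
  then show ?case using Suc assms by simp
qed simp

lemma map_fst_tree_overlap: "map fst (tree_overlap p q n) = tree_seq p q (Suc n)"
proof (induction n)
  case (Suc n)
  have "map fst (map (map_prod ((*) s) ((*) s)) xs) = map ((*) s) (map fst xs)"
    for s :: real and xs :: "(real \<times> real) list"
    by simp
  with Suc show ?case
    by (simp only: tree_overlap.simps tree_seq.simps(2)[of p q "Suc n"] list.map map_append fst_conv)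
qed simp

lemma nonzeros_snd_tree_overlap:
  "nonzeros (map snd (tree_overlap p q n)) = nonzeros (tree_seq p q n)"
proof (induction n)
  case (Suc n)
  have "map snd (map (map_prod ((*) s) ((*) s)) xs) = map ((*) s) (map snd xs)"
    for s :: real and xs :: "(real \<times> real) list"
    by simp
  with Suc show ?case
    by (simp only: tree_overlap.simps tree_seq.simps list.map map_append snd_conv
        filter_append filter.simps nonzeros_scale)
qed simp

text \<open>Each second component is either zero or equal to the first, so the sum is the squared
  norm of \<open>tree_seq p q n\<close>.\<close>

lemma tree_overlap_inner:
  assumes "p\<^sup>2 + q\<^sup>2 = 1"
  shows "(\<Sum>z\<leftarrow>tree_overlap p q n. fst z * snd z) = real n"
proof (induction n)
  case (Suc n)
  have scale: "(\<Sum>z\<leftarrow>map (map_prod ((*) s) ((*) s)) xs. fst z * snd z)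
      = s\<^sup>2 * (\<Sum>z\<leftarrow>xs. fst z * snd z)" for s :: real and xs
    by (simp add: o_def power2_eq_square sum_list_const_mult[symmetric] mult_ac)
  have "(\<Sum>z\<leftarrow>tree_overlap p q (Suc n). fst z * snd z)
      = 1 + (p\<^sup>2 + q\<^sup>2) * (\<Sum>z\<leftarrow>tree_overlap p q n. fst z * snd z)"
    unfolding tree_overlap.simps map_append sum_list_append list.map(2) sum_list.Cons scale
    by (simp add: algebra_simps)
  then show ?case using Suc assms by simp
qed simp

text \<open>Each triple holds one coordinate of three vectors. The tree lists only approach the
  bounding circle, hence the strict inequality
  \<open>x\<^sup>2 + y\<^sup>2 < h\<^sup>2\<close>.\<close>

lemma overlapping_patterns:
  fixes x y h :: real
  assumes "0 \<le> x" "0 \<le> y" "0 < h" "x\<^sup>2 + y\<^sup>2 < h\<^sup>2"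
  obtains T :: "(real \<times> real \<times> real) list" and \<alpha> where
    "nonzeros (map fst T) = \<alpha>" "nonzeros (map (fst \<circ> snd) T) = \<alpha>"
    "nonzeros (map (snd \<circ> snd) T) = \<alpha>"
    "\<forall>t\<in>set \<alpha>. 0 \<le> t" "(\<Sum>t\<leftarrow>\<alpha>. t\<^sup>2) = h"
    "(\<Sum>(a, b, c)\<leftarrow>T. a * b) = 0" "(\<Sum>(a, b, c)\<leftarrow>T. a * c) = x" "(\<Sum>(a, b, c)\<leftarrow>T. b * c) = y"
proof -
  define s where "s = sqrt (x\<^sup>2 + y\<^sup>2)"
  have s: "0 \<le> s" "s < h" "s\<^sup>2 = x\<^sup>2 + y\<^sup>2"
    using assms by (auto simp: s_def intro: real_less_lsqrt)
  \<comment> \<open>Polar form of \<open>(x, y)\<close>; at the origin any direction will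
    do.\<close>
  obtain p q where pq: "0 \<le> p" "0 \<le> q" "p\<^sup>2 + q\<^sup>2 = 1" "x = s * p" "y = s * q"
  proof (cases "s = 0")
    case True
    then have "x = 0" "y = 0"
      using s(3) by auto
    then show ?thesis using that[of 1 0] True by simp
  next
    case False
    then have "(x / s)\<^sup>2 + (y / s)\<^sup>2 = 1"
      by (simp add: power_divide add_divide_distrib[symmetric] s(3)[symmetric])
    then show ?thesis using that[of "x / s" "y / s"] False s(1) assms by simp
  qed
  \<comment> \<open>This is \<open>s * (N + 1) / N < h\<close>: after scaling by \<open>k\<close>,
    which turns the inner product \<open>N\<close> into \<open>s\<close>, the list of squared norm
    \<open>N + 1\<close> still has squared norm below \<open>h\<close>. The entry \<open>e\<close>
    supplies the rest.\<close>
  obtain N :: nat where N: "s < real N * (h - s)"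
    using reals_Archimedean3[of "h - s"] s(2) by auto
  then have "0 < N" using s(1) by (cases N) auto
  define k e where "k = sqrt (s / N)" and "e = sqrt (h - s * (N + 1) / N)"
  have k: "0 \<le> k" "k\<^sup>2 * N = s"
    using s(1) \<open>0 < N\<close> by (auto simp: k_def)
  have e: "0 \<le> e" "e\<^sup>2 + k\<^sup>2 * (N + 1) = h"
    using s(1) \<open>0 < N\<close> N by (auto simp: k_def e_def field_simps)
  define \<alpha> where "\<alpha> = nonzeros (map ((*) k) (tree_seq p q (Suc N)) @ [e])"
  \<comment> \<open>The leading entry of the third list stands alone, its \<open>p\<close> part
    overlaps the first list and its \<open>q\<close> part the second. The three copies of
    \<open>e\<close> occupy separate coordinates.\<close>
  define T where "T = [(0, 0, k)] @
    map (\<lambda>(a, c). (k * a, 0, k * (p * c))) (tree_overlap p q N) @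
    map (\<lambda>(b, c). (0, k * b, k * (q * c))) (tree_overlap p q N) @
    [(e, 0, 0), (0, e, 0), (0, 0, e)]"
  have zeros: "nonzeros (map (\<lambda>_. 0) xs) = []" for xs :: "(real \<times> real) list"
    by (induction xs) auto
  have first: "map (\<lambda>z. k * fst z) (tree_overlap p q N) = map ((*) k) (tree_seq p q (Suc N))"
    unfolding map_fst_tree_overlap[symmetric] by simp
  have second: "nonzeros (map (\<lambda>z. k * (t * snd z)) (tree_overlap p q N))
      = nonzeros (map ((*) k) (map ((*) t) (tree_seq p q N)))" for t
  proof -
    have "map (\<lambda>z. k * (t * snd z)) (tree_overlap p q N)
        = map ((*) k) (map ((*) t) (map snd (tree_overlap p q N)))" by simp
    then show ?thesis
      by (simp only: nonzeros_scale nonzeros_snd_tree_overlap)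
  qed
  show thesis
  proof (rule that)
    show "nonzeros (map fst T) = \<alpha>"
      by (simp add: T_def \<alpha>_def case_prod_unfold o_def first zeros del: tree_seq.simps)
    show "nonzeros (map (fst \<circ> snd) T) = \<alpha>"
      by (simp add: T_def \<alpha>_def case_prod_unfold o_def first zeros del: tree_seq.simps)
    show "nonzeros (map (snd \<circ> snd) T) = \<alpha>"
      by (simp add: T_def \<alpha>_def case_prod_unfold o_def second)
    show "\<forall>t\<in>set \<alpha>. 0 \<le> t"
      using k(1) e(1) tree_seq_nonneg[OF pq(1,2)] by (auto simp: \<alpha>_def simp del: tree_seq.simps)
    have "(\<Sum>t\<leftarrow>\<alpha>. t\<^sup>2) = (\<Sum>t\<leftarrow>map ((*) k) (tree_seq p q (Suc N)) @ [e]. t\<^sup>2)"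
      unfolding \<alpha>_def by (rule sum_list_nonzeros) simp
    also have "\<dots> = k\<^sup>2 * (N + 1) + e\<^sup>2"
      unfolding map_append sum_list_append sum_list_scale_squares tree_seq_norm[OF pq(3)] by simp
    finally show "(\<Sum>t\<leftarrow>\<alpha>. t\<^sup>2) = h"
      using e(2) by simp
    have inner: "(\<Sum>z\<leftarrow>tree_overlap p q N. k * fst z * (k * (t * snd z))) = s * t" for t
    proof -
      have "(\<Sum>z\<leftarrow>tree_overlap p q N. k * fst z * (k * (t * snd z)))
          = (\<Sum>z\<leftarrow>tree_overlap p q N. k\<^sup>2 * t * (fst z * snd z))"
        by (simp add: power2_eq_square mult_ac)
      also have "\<dots> = s * t"
        unfolding sum_list_const_mult tree_overlap_inner[OF pq(3)] using k(2) by (simp add: mult_ac)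
      finally show ?thesis .
    qed
    show "(\<Sum>(a, b, c)\<leftarrow>T. a * b) = 0"
      by (simp add: T_def case_prod_unfold o_def)
    show "(\<Sum>(a, b, c)\<leftarrow>T. a * c) = x"
      by (simp add: T_def case_prod_unfold o_def inner pq)
    show "(\<Sum>(a, b, c)\<leftarrow>T. b * c) = y"
      by (simp add: T_def case_prod_unfold o_def inner pq)
  qed
qed

section \<open>Realising the triangle\<close>

lemma sum_squared_differences:
  fixes f g :: "'b \<Rightarrow> real"
  assumes "nonzeros (map f T) = \<alpha>" "nonzeros (map g T) = \<alpha>"
  shows "(\<Sum>j<length T. (map f T ! j - map g T ! j)\<^sup>2)
    = 2 * (\<Sum>t\<leftarrow>\<alpha>. t\<^sup>2) - 2 * (\<Sum>z\<leftarrow>T. f z * g z)"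
proof -
  have norm: "(\<Sum>z\<leftarrow>T. (u z)\<^sup>2) = (\<Sum>t\<leftarrow>\<alpha>. t\<^sup>2)" if "nonzeros (map u T) = \<alpha>" for u
    using sum_list_nonzeros[of "\<lambda>t. t\<^sup>2" "map u T"] that by (simp add: o_def)
  have "(\<Sum>j<length T. (map f T ! j - map g T ! j)\<^sup>2) = (\<Sum>z\<leftarrow>T. (f z - g z)\<^sup>2)"
    by (simp add: sum_list_sum_nth atLeast0LessThan)
  also have "\<dots> = (\<Sum>z\<leftarrow>T. (f z)\<^sup>2) + (\<Sum>z\<leftarrow>T. (g z)\<^sup>2) - 2 * (\<Sum>z\<leftarrow>T. f z * g z)"
    by (induction T) (auto simp: power2_diff algebra_simps)
  finally show ?thesis
    using norm[OF assms(1)] norm[OF assms(2)] by simp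
qed

text \<open>With \<open>A B\<close> a longest side, the angle at \<open>C\<close> is a largest
  one.\<close>

lemma diameter_Ramsey_triangle:
  fixes A B C :: "'a::euclidean_space"
  assumes distinct: "A \<noteq> B" "A \<noteq> C" "B \<noteq> C"
    and longest: "dist A C \<le> dist A B" "dist B C \<le> dist A B"
    and angle: "vertex_angle A C B < 3 * pi / 4"
  shows "diameter_Ramsey {A, B, C}"
proof -
  define u v where "u = A - C" and "v = B - C"
  \<comment> \<open>Vectors of squared norm \<open>h\<close> representing \<open>A\<close> and
    \<open>B\<close> are orthogonal, and \<open>x\<close> and \<open>y\<close> are the inner
    products they must have with the one representing \<open>C\<close>.\<close>
  define h x y where "h = (dist A B)\<^sup>2 / 2"
    and "x = h - (dist A C)\<^sup>2 / 2" and "y = h - (dist B C)\<^sup>2 / 2"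
  have dists: "(dist A C)\<^sup>2 = u \<bullet> u" "(dist B C)\<^sup>2 = v \<bullet> v"
    "(dist A B)\<^sup>2 = u \<bullet> u + v \<bullet> v - 2 * (u \<bullet> v)"
    by (simp_all add: u_def v_def dist_norm power2_norm_eq_inner inner_diff inner_commute)
  have "0 < h" using distinct by (simp add: h_def)
  have xy: "0 \<le> x" "0 \<le> y"
    using longest by (simp_all add: h_def x_def y_def power_mono)
  have pos: "0 < norm u" "0 < norm v"
    using distinct by (simp_all add: u_def v_def)
  \<comment> \<open>The difference of the two sides is twice
    \<open>h\<^sup>2 - x\<^sup>2 - y\<^sup>2\<close>, and the claim says that the squared cosine at
    \<open>C\<close> is below 1/2. For a nonnegative cosine this follows from \<open>A B\<close>
    being longest, for a negative one from the angle bound.\<close>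
  have "2 * (u \<bullet> v)\<^sup>2 < (u \<bullet> u) * (v \<bullet> v)"
  proof (cases "0 \<le> u \<bullet> v")
    case True
    have "2 * (u \<bullet> v) \<le> u \<bullet> u" "2 * (u \<bullet> v) \<le> v \<bullet> v"
      using xy dists by (simp_all add: h_def x_def y_def)
    then have "(2 * (u \<bullet> v)) * (2 * (u \<bullet> v)) \<le> (u \<bullet> u) * (v \<bullet> v)"
      using True by (intro mult_mono) auto
    moreover have "0 < (u \<bullet> u) * (v \<bullet> v)"
      using pos by simp
    ultimately show ?thesis by (simp add: power2_eq_square)
  next
    case False
    define t where "t = (u \<bullet> v) / (norm u * norm v)"
    have t: "\<bar>t\<bar> \<le> 1"
      using Cauchy_Schwarz_ineq2[of u v] pos by (simp add: t_def abs_mult)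
    have "cos (3 * pi / 4) < cos (arccos t)"
    proof (rule cos_monotone_0_pi)
      show "0 \<le> arccos t" using t by (intro arccos_lbound) auto
      show "arccos t < 3 * pi / 4"
        using angle by (simp add: vertex_angle_def t_def u_def v_def)
    qed simp
    moreover have "cos (3 * pi / 4) = - (sqrt 2 / 2)"
      using cos_minus_pi[of "pi / 4"] by (simp add: cos_45 field_simps)
    ultimately have "- t < sqrt 2 / 2"
      using t by (simp add: cos_arccos_abs)
    moreover have "t < 0"
      using False pos by (simp add: t_def divide_neg_pos)
    ultimately have "(- t)\<^sup>2 < (sqrt 2 / 2)\<^sup>2"
      by (intro power_strict_mono) auto
    then have "t\<^sup>2 < 1 / 2" by (simp add: power_divide)
    moreover have "(u \<bullet> v)\<^sup>2 = t\<^sup>2 * ((u \<bullet> u) * (v \<bullet> v))"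
      using pos by (simp add: t_def power_divide power_mult_distrib power2_norm_eq_inner)
    moreover have "0 < (u \<bullet> u) * (v \<bullet> v)"
      using pos by simp
    ultimately show ?thesis
      using mult_strict_right_mono[of "t\<^sup>2" "1/2" "(u \<bullet> u) * (v \<bullet> v)"] by simp
  qed
  then have "x\<^sup>2 + y\<^sup>2 < h\<^sup>2"
    unfolding x_def y_def h_def dists by (simp add: power2_eq_square field_simps)
  then obtain T \<alpha> where pat: "nonzeros (map fst T) = \<alpha>" "nonzeros (map (fst \<circ> snd) T) = \<alpha>"
    "nonzeros (map (snd \<circ> snd) T) = \<alpha>"
    and nonneg: "\<forall>t\<in>set \<alpha>. 0 \<le> t" and norm: "(\<Sum>t\<leftarrow>\<alpha>. t\<^sup>2) = h"
    and inner: "(\<Sum>(a, b, c)\<leftarrow>T. a * b) = 0" "(\<Sum>(a, b, c)\<leftarrow>T. a * c) = x"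
      "(\<Sum>(a, b, c)\<leftarrow>T. b * c) = y"
    using overlapping_patterns[OF xy \<open>0 < h\<close>] by metis
  define w where "w z = (if z = A then map fst T else if z = B then map (fst \<circ> snd) T
    else map (snd \<circ> snd) T)" for z
  have w: "w A = map fst T" "w B = map (fst \<circ> snd) T" "w C = map (snd \<circ> snd) T"
    using distinct by (auto simp: w_def)
  let ?S = "\<lambda>z z'. \<Sum>j<length T. (w z ! j - w z' ! j)\<^sup>2"
  have sym: "?S z z' = ?S z' z" for z z'
    by (simp add: power2_commute)
  have "?S A B = (dist A B)\<^sup>2" "?S A C = (dist A C)\<^sup>2" "?S B C = (dist B C)\<^sup>2"
    unfolding w using inner sum_squared_differences[OF pat(1,2)] sum_squared_differences[OF pat(1,3)]
      sum_squared_differences[OF pat(2,3)]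
    by (simp_all add: norm case_prod_unfold h_def x_def y_def del: nth_map)
  then have S: "?S z z' = (dist z z')\<^sup>2" if "z \<in> {A, B, C}" "z' \<in> {A, B, C}" for z z'
    using that sym[of B A] sym[of C A] sym[of C B] by (auto simp: dist_commute)
  show ?thesis
  proof (rule diameter_RamseyI[where w=w and m="length T" and \<alpha>=\<alpha>])
    show "length (w z) = length T" if "z \<in> {A, B, C}" for z
      by (simp add: w_def)
    show "nonzeros (w z) = \<alpha>" if "z \<in> {A, B, C}" for z
      using that w pat by auto
    have "diam dist {A, B, C} = dist A B"
      unfolding diam_def
    proof (rule Max_eqI)
      show "finite {dist z z' | z z'. z \<in> {A, B, C} \<and> z' \<in> {A, B, C}}"
        by (intro finite_image_set2) auto
    qed (use longest in \<open>auto simp: dist_commute\<close>)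
    then show "diam dist {A, B, C} = sqrt (2 * (\<Sum>t\<leftarrow>\<alpha>. t\<^sup>2))"
      by (simp add: norm h_def)
    show "dist z z' = sqrt (?S z z')" if "z \<in> {A, B, C}" "z' \<in> {A, B, C}" for z z'
      using S[OF that] by simp
  qed (use nonneg in auto)
qed

lemma vertex_angle_commute: "vertex_angle A B C = vertex_angle C B A"
  by (simp add: vertex_angle_def inner_commute mult.commute)

theorem theorem1p2:
  fixes A B C :: "'a::euclidean_space"
  assumes "\<not> collinear {A, B, C}"
    and "Max {vertex_angle C A B, vertex_angle A B C, vertex_angle B C A} < 3 * pi / 4"
  shows "diameter_Ramsey {A, B, C}"
proof -
  have distinct: "A \<noteq> B" "A \<noteq> C" "B \<noteq> C"
    using assms(1) by (auto simp: insert_commute)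
  have angles: "vertex_angle C A B < 3 * pi / 4" "vertex_angle A B C < 3 * pi / 4"
    "vertex_angle A C B < 3 * pi / 4"
    using assms(2) vertex_angle_commute[of A C B] by auto
  \<comment> \<open>The vertices are relabelled so that the third one is opposite a longest
    side.\<close>
  consider "dist A C \<le> dist A B" "dist B C \<le> dist A B"
    | "dist A B \<le> dist A C" "dist B C \<le> dist A C"
    | "dist A B \<le> dist B C" "dist A C \<le> dist B C"
    by linarith
  then show ?thesis
  proof cases
    case 1
    then show ?thesis
      by (intro diameter_Ramsey_triangle distinct angles)
  next
    case 2
    then have "diameter_Ramsey {A, C, B}"
      using distinct angles by (intro diameter_Ramsey_triangle) (auto simp: dist_commute)
    then show ?thesis by (simp add: insert_commute)
  next
    case 3
    then have "diameter_Ramsey {C, B, A}"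
      using distinct angles by (intro diameter_Ramsey_triangle) (auto simp: dist_commute)
    then show ?thesis by (simp add: insert_commute)
  qed
qed

end
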